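(* The generating functions (as formal power series in $x$ with $3\times 3$ matrix coefficients) of the negative-index Tribonacci and Tribonacci-Lucas matrix sequences are $$\sum_{n=0}^{\infty}\mathcal{T}_{-n}x^{n}=\frac{1}{1+x+x^{2}-x^{3}}\begin{pmatrix} x^{2}+x+1 & x^{2}+x & x^{2} \\ x^{2} & x+1 & x \\ x & x^{2}-x & 1 \end{pmatrix}$$ and $$\sum_{n=0}^{\infty}\mathcal{K}_{-n}x^{n}=\frac{1}{1+x+x^{2}-x^{3}}\begin{pmatrix} 3x^{2}+4x+1 & 4x^{2}+2 & x^{2}+2x+3 \\ x^{2}+2x+3 & 2x^{2}+2x-2 & 3x^{2}-2x-1 \\ 3x^{2}-2x-1 & -2x^{2}+4x+4 & -x^{2}+4x-1 \end{pmatrix}.$$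
   Context: The negative-index Tribonacci matrix sequence $(\mathcal{T}_{-n})_{n\ge 0}$ and Tribonacci-Lucas matrix sequence $(\mathcal{K}_{-n})_{n\ge 0}$ are the sequences of $3\times 3$ matrices defined, for $n\ge 3$, by $\mathcal{T}_{-n}=\mathcal{T}_{-n+3}-\mathcal{T}_{-n+2}-\mathcal{T}_{-n+1}$ and $\mathcal{K}_{-n}=\mathcal{K}_{-n+3}-\mathcal{K}_{-n+2}-\mathcal{K}_{-n+1}$, with initial conditions $$\mathcal{T}_{0}=I_3,\quad \mathcal{T}_{-1}=\begin{pmatrix} 0&1&0 \\ 0&0&1 \\ 1&-1&-1 \end{pmatrix},\quad \mathcal{T}_{-2}=\begin{pmatrix} 0&0&1 \\ 1&-1&-1 \\ -1&2&0 \end{pmatrix},$$ $$\mathcal{K}_{0}=\begin{pmatrix} 1&2&3 \\ 3&-2&-1 \\ -1&4&-1 \end{pmatrix},\quad \mathcal{K}_{-1}=\begin{pmatrix} 3&-2&-1 \\ -1&4&-1 \\ -1&0&5 \end{pmatrix},\quad \mathcal{K}_{-2}=\begin{pmatrix} -1&4&-1 \\ -1&0&5 \\ 5&-6&-5 \end{pmatrix}.$$ *)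

theory Defs
  imports "HOL-Analysis.Analysis" "HOL-Computational_Algebra.Formal_Power_Series"
begin

text \<open>The value at \<open>n\<close> is the matrix with index \<open>-n\<close>.\<close>

fun trib_neg :: "nat \<Rightarrow> real^3^3" where
  "trib_neg 0 = mat 1"
| "trib_neg (Suc 0) = vector [vector [0, 1, 0], vector [0, 0, 1], vector [1, -1, -1]]"
| "trib_neg (Suc (Suc 0)) = vector [vector [0, 0, 1], vector [1, -1, -1], vector [-1, 2, 0]]"
| "trib_neg (Suc (Suc (Suc n))) =
     trib_neg n - trib_neg (Suc n) - trib_neg (Suc (Suc n))"

fun trib_lucas_neg :: "nat \<Rightarrow> real^3^3" where
  "trib_lucas_neg 0 = vector [vector [1, 2, 3], vector [3, -2, -1], vector [-1, 4, -1]]"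
| "trib_lucas_neg (Suc 0) =
     vector [vector [3, -2, -1], vector [-1, 4, -1], vector [-1, 0, 5]]"
| "trib_lucas_neg (Suc (Suc 0)) =
     vector [vector [-1, 4, -1], vector [-1, 0, 5], vector [5, -6, -5]]"
| "trib_lucas_neg (Suc (Suc (Suc n))) =
     trib_lucas_neg n - trib_lucas_neg (Suc n) - trib_lucas_neg (Suc (Suc n))"

text \<open>The canonical identification of matrices of formal power series with formal power
  series of matrices: the \<open>n\<close>-th coefficient is formed entrywise.\<close>

definition fps_of_matrix :: "('a::zero fps)^'n^'m \<Rightarrow> ('a^'n^'m) fps" where
  "fps_of_matrix M = Abs_fps (\<lambda>n. map_matrix (\<lambda>p. fps_nth p n) M)"

lemma bij_fps_of_matrix: "bij (fps_of_matrix :: ('a::zero fps)^'n^'m \<Rightarrow> ('a^'n^'m) fps)"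
proof (rule bijI)
  show "inj (fps_of_matrix :: ('a fps)^'n^'m \<Rightarrow> ('a^'n^'m) fps)"
    by (rule injI) (simp add: fps_of_matrix_def map_matrix_def fps_eq_iff vec_eq_iff)
  show "surj (fps_of_matrix :: ('a fps)^'n^'m \<Rightarrow> ('a^'n^'m) fps)"
  proof (rule surjI)
    fix F :: "('a^'n^'m) fps"
    show "fps_of_matrix (\<chi> i j. Abs_fps (\<lambda>n. fps_nth F n $ i $ j)) = F"
      by (simp add: fps_of_matrix_def map_matrix_def fps_eq_iff vec_eq_iff)
  qed
qed

end

theory Submission
  imports Defs
begin

text \<open>Both sequences satisfy the recurrence with characteristic series
  \<open>1 + x + x\<^sup>2 - x\<^sup>3\<close>. Multiplying a generating function by this series therefore
  annihilates every coefficient of degree at least \<open>3\<close> and leaves a polynomial of degree at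
  most \<open>2\<close>, determined by the three initial values (\<open>trib_recurrence_gf\<close>). The series
  has constant term \<open>1\<close>, hence is invertible, and dividing by it gives the closed form. As
  matrix addition is entrywise, each of the nine entries is a scalar instance
  (\<open>matrix_trib_recurrence_gf\<close>), and only the numerator matrices remain to be compared with
  the initial matrices.\<close>

text \<open>The coefficients of the numerator are the partial sums of the initial values, because
  the characteristic series starts with \<open>1 + x + x\<^sup>2\<close> and its \<open>x\<^sup>3\<close> term cannot
  contribute below degree \<open>3\<close>.\<close>

lemma trib_recurrence_gf:
  fixes a :: "nat \<Rightarrow> 'a::field"
  assumes rec: "\<And>n. a (n + 3) = a n - a (n + 1) - a (n + 2)"
  shows "Abs_fps a = 1 / (1 + fps_X + fps_X^2 - fps_X^3) *
    (fps_const (a 0) + fps_const (a 0 + a 1) * fps_X + fps_const (a 0 + a 1 + a 2) * fps_X^2)"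
    (is "?F = 1 / ?D * ?N")
proof -
  have "?D * ?F = ?N"
  proof (rule fps_ext)
    fix n :: nat
    have "n = 0 \<or> n = 1 \<or> n = 2 \<or> n = (n - 3) + 3"
      by arith
    then consider "n = 0" | "n = 1" | "n = 2" | k where "n = k + 3"
      by metis
    then show "fps_nth (?D * ?F) n = fps_nth ?N n"
      by cases (simp_all add: algebra_simps fps_X_power_mult_right_nth rec)
  qed
  moreover have unit: "?D dvd 1"
    by simp
  then have "?D \<noteq> 0"
    using not_is_unit_0 by metis
  ultimately have "?F = ?N / ?D"
    using nonzero_mult_div_cancel_left by metis
  also have "\<dots> = 1 / ?D * ?N"
    by (simp only: mult.commute[of "1 / ?D"] unit_div_mult_swap[OF unit] mult_1_right)
  finally show ?thesis .
qed

text \<open>The numerator condition is an object-level quantification over the indices, so that for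
  \<open>3 \<times> 3\<close> matrices \<open>forall_3\<close> unfolds it into nine polynomial identities.\<close>

lemma matrix_trib_recurrence_gf:
  fixes F :: "nat \<Rightarrow> 'a::field^'n^'m"
  assumes rec: "\<And>n. F (n + 3) = F n - F (n + 1) - F (n + 2)"
    and num: "\<forall>i j. M $ i $ j = fps_const (F 0 $ i $ j)
      + fps_const (F 0 $ i $ j + F 1 $ i $ j) * fps_X
      + fps_const (F 0 $ i $ j + F 1 $ i $ j + F 2 $ i $ j) * fps_X^2"
  shows "Abs_fps F =
    fps_of_matrix (map_matrix (\<lambda>p. 1 / (1 + fps_X + fps_X^2 - fps_X^3) * p) M)"
proof -
  have entry: "Abs_fps (\<lambda>n. F n $ i $ j) = 1 / (1 + fps_X + fps_X^2 - fps_X^3) * M $ i $ j"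
    for i j
    unfolding num[rule_format] by (rule trib_recurrence_gf) (simp add: rec)
  show ?thesis
    by (simp add: fps_of_matrix_def map_matrix_def fps_eq_iff vec_eq_iff flip: entry)
qed

theorem theorem2p7:
  shows "Abs_fps trib_neg =
    fps_of_matrix (map_matrix
      (\<lambda>p. 1 / (1 + fps_X + fps_X^2 - fps_X^3) * p)
      (vector [
        vector [fps_X^2 + fps_X + 1, fps_X^2 + fps_X, fps_X^2],
        vector [fps_X^2, fps_X + 1, fps_X],
        vector [fps_X, fps_X^2 - fps_X, 1]] :: (real fps)^3^3))
    \<and> Abs_fps trib_lucas_neg =
    fps_of_matrix (map_matrix
      (\<lambda>p. 1 / (1 + fps_X + fps_X^2 - fps_X^3) * p)
      (vector [
        vector [3 * fps_X^2 + 4 * fps_X + 1, 4 * fps_X^2 + 2, fps_X^2 + 2 * fps_X + 3],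
        vector [fps_X^2 + 2 * fps_X + 3, 2 * fps_X^2 + 2 * fps_X - 2, 3 * fps_X^2 - 2 * fps_X - 1],
        vector [3 * fps_X^2 - 2 * fps_X - 1, -2 * fps_X^2 + 4 * fps_X + 4, - (fps_X^2) + 4 * fps_X - 1]]
        :: (real fps)^3^3))"
proof (intro conjI matrix_trib_recurrence_gf)
  show "trib_neg (n + 3) = trib_neg n - trib_neg (n + 1) - trib_neg (n + 2)" for n
    by (simp add: numeral_3_eq_3)
  show "trib_lucas_neg (n + 3) =
      trib_lucas_neg n - trib_lucas_neg (n + 1) - trib_lucas_neg (n + 2)" for n
    by (simp add: numeral_3_eq_3)
  \<comment> \<open>The numerator identities remain. The flipped rules turn the constant series of the
    partial sums back into the numerals and signs of the stated matrices.\<close>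
qed (simp_all add: forall_3 mat_def numeral_2_eq_2
    flip: fps_const_neg numeral_fps_const)

end
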